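(* For $n\ge1$, we have $\mathbf{I}_n(000,001)=\mathbf{I}_n(=,\le,-)$. Consequently, the cardinality of $\mathbf{I}_n(000,001)$ is $F_{n+1}$, where $F_m$ is the $m$-th Fibonacci number.
   Context: An inversion sequence of length $n$ is an integer sequence $e=(e_1,\dots,e_n)$ with $0\le e_i\le i-1$ for all $1\le i\le n$. A word $w_1\cdots w_n$ avoids a pattern $P=p_1\cdots p_k$ if there are no $i_1<\cdots<i_k$ such that $w_{i_1}\cdots w_{i_k}$ is order isomorphic to $P$ (equal letters of $P$ corresponding to equal entries). $\mathbf{I}_n(000,001)$ is the set of inversion sequences of length $n$ avoiding both $000$ and $001$. $\mathbf{I}_n(=,\le,-)$ is the set of inversion sequences $e$ of length $n$ with no $i<j<k$ such that $e_i=e_j$ and $e_j\le e_k$ (the relation "$-$" between $e_i$ and $e_k$ imposes no condition). Fibonacci numbers: $F_0=0$, $F_1=1$, $F_m=F_{m-1}+F_{m-2}$ for $m\ge2$. *)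

theory Defs
  imports "HOL-Library.Sublist" "HOL-Number_Theory.Fib"
begin

(* Sequences are lists indexed from 0, so the bounds 0 <= e_i <= i - 1 (1 <= i <= n)
   become e ! i <= i for i < n. *)
definition inversion_sequences :: "nat \<Rightarrow> nat list set" where
  "inversion_sequences n = {e. length e = n \<and> (\<forall>i<n. e ! i \<le> i)}"

definition order_isomorphic :: "'a::linorder list \<Rightarrow> 'b::linorder list \<Rightarrow> bool" where
  "order_isomorphic u v \<longleftrightarrow> length u = length v \<and>
     (\<forall>i<length u. \<forall>j<length u.
        (u ! i < u ! j \<longleftrightarrow> v ! i < v ! j) \<and> (u ! i = u ! j \<longleftrightarrow> v ! i = v ! j))"

(* subseq u w means that u is a not necessarily contiguous subword of w *)
definition avoids :: "'a::linorder list \<Rightarrow> nat list \<Rightarrow> bool" where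
  "avoids w p \<longleftrightarrow> \<not> (\<exists>u. subseq u w \<and> order_isomorphic u p)"

definition I_patterns :: "nat \<Rightarrow> nat list set \<Rightarrow> nat list set" where
  "I_patterns n P = {e \<in> inversion_sequences n. \<forall>p\<in>P. avoids e p}"

(* The third relation compares the first and the last of the three entries. *)
definition I_relations ::
  "nat \<Rightarrow> (nat \<Rightarrow> nat \<Rightarrow> bool) \<Rightarrow> (nat \<Rightarrow> nat \<Rightarrow> bool) \<Rightarrow> (nat \<Rightarrow> nat \<Rightarrow> bool) \<Rightarrow> nat list set" where
  "I_relations n r1 r2 r3 = {e \<in> inversion_sequences n.
     \<not> (\<exists>i j k. i < j \<and> j < k \<and> k < n \<and>
          r1 (e ! i) (e ! j) \<and> r2 (e ! j) (e ! k) \<and> r3 (e ! i) (e ! k))}"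

(* the relation written "-" *)
definition no_condition :: "nat \<Rightarrow> nat \<Rightarrow> bool" where
  "no_condition x y \<longleftrightarrow> True"

end

theory Submission
  imports Defs
begin

text \<open>
  The first claim only unfolds the notation: the three-letter words order isomorphic to \<open>000\<close> or
  \<open>001\<close> are the words \<open>a a c\<close> with \<open>a \<le> c\<close>.

  For the count, index the entries from \<open>0\<close> and let \<open>m\<close> be the first position at which
  \<open>e\<^sub>m \<noteq> m\<close> (or the length \<open>n\<close> if there is none). Then \<open>e\<close> begins with \<open>0, 1, \<dots>, m - 1\<close>, and
  \<open>e\<^sub>m < m\<close> repeats one of these values, so every later entry lies strictly below \<open>e\<^sub>m\<close>.
  Each of them is therefore a repetition as well and again forces everything after it to be
  strictly smaller.
  Hence the remaining entries form a strictly decreasing word over \<open>{0, \<dots>, m - 1}\<close>. Conversely, in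
  a sequence of this shape the second of two equal entries belongs to the decreasing part, so no
  later entry can reach its value. Such sequences correspond to the pairs of an \<open>m \<le> n\<close> and an
  \<open>(n - m)\<close>-element subset of \<open>{0, \<dots>, m - 1}\<close>; there are \<open>\<Sum>\<^sub>m (m choose (n - m))\<close> of them,
  which is the Fibonacci number obtained as a diagonal sum of Pascal's triangle.
\<close>

lemma subseq_Cons_iff_nth:
  "subseq (x # xs) w \<longleftrightarrow> (\<exists>i<length w. w ! i = x \<and> subseq xs (drop (Suc i) w))"
proof
  assume "subseq (x # xs) w"
  then obtain us vs where w: "w = us @ x # vs" "subseq xs vs"
    by (auto dest: list_emb_ConsD)
  then show "\<exists>i<length w. w ! i = x \<and> subseq xs (drop (Suc i) w)"
    by (intro exI[of _ "length us"]) auto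
next
  assume "\<exists>i<length w. w ! i = x \<and> subseq xs (drop (Suc i) w)"
  then obtain i where i: "i < length w" "w ! i = x" "subseq xs (drop (Suc i) w)" by blast
  then have "subseq (x # xs) (drop i w)"
    by (simp flip: Cons_nth_drop_Suc)
  then show "subseq (x # xs) w"
    by (metis append_take_drop_id list_emb_append2)
qed

lemma subseq_three_iff_nth:
  "subseq [a, b, c] w \<longleftrightarrow>
    (\<exists>i j k. i < j \<and> j < k \<and> k < length w \<and> w ! i = a \<and> w ! j = b \<and> w ! k = c)"
proof
  assume "subseq [a, b, c] w"
  then obtain i where i: "i < length w" "w ! i = a" "subseq [b, c] (drop (Suc i) w)"
    unfolding subseq_Cons_iff_nth[of a] by blast
  from i(3) obtain j where j: "j < length w - Suc i" "w ! (Suc i + j) = b"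
      "subseq [c] (drop (Suc i + Suc j) w)"
    unfolding subseq_Cons_iff_nth[of b] by (auto simp: add_ac)
  from j(3) obtain k where "k < length w - (Suc i + Suc j)" "w ! (Suc i + Suc j + k) = c"
    unfolding subseq_Cons_iff_nth by auto
  with i j show "\<exists>i j k. i < j \<and> j < k \<and> k < length w \<and> w ! i = a \<and> w ! j = b \<and> w ! k = c"
    by (intro exI[of _ i] exI[of _ "Suc i + j"] exI[of _ "Suc i + Suc j + k"]) auto
next
  assume "\<exists>i j k. i < j \<and> j < k \<and> k < length w \<and> w ! i = a \<and> w ! j = b \<and> w ! k = c"
  then obtain i j k where "i < j" "j < k" "k < length w" "w ! i = a" "w ! j = b" "w ! k = c"
    by blast
  then show "subseq [a, b, c] w"
    unfolding subseq_Cons_iff_nth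
    by (intro exI[of _ i] exI[of _ "j - Suc i"] exI[of _ "k - Suc j"] conjI) auto
qed

lemma order_isomorphic_000_or_001_iff:
  "order_isomorphic u [0, 0, 0::nat] \<or> order_isomorphic u [0, 0, 1::nat] \<longleftrightarrow>
    (\<exists>a c. u = [a, a, c] \<and> a \<le> c)"
proof -
  have len: "length u = 3 \<longleftrightarrow> (\<exists>a b c. u = [a, b, c])"
    by (auto simp: length_Suc_conv numeral_3_eq_3)
  have "order_isomorphic [a, b, c] [0, 0, 0::nat] \<or> order_isomorphic [a, b, c] [0, 0, 1::nat] \<longleftrightarrow>
      a = b \<and> a \<le> c" for a b c :: 'a
    by (auto simp: order_isomorphic_def All_less_Suc)
  moreover have "length u = 3"
    if "order_isomorphic u [0, 0, 0::nat] \<or> order_isomorphic u [0, 0, 1::nat]"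
    using that by (auto simp: order_isomorphic_def)
  ultimately show ?thesis
    by (metis len)
qed

lemma avoids_000_001_iff:
  "avoids e [0, 0, 0] \<and> avoids e [0, 0, 1] \<longleftrightarrow>
    \<not> (\<exists>i j k. i < j \<and> j < k \<and> k < length e \<and> e ! i = e ! j \<and> e ! j \<le> e ! k)"
proof -
  have "avoids e [0, 0, 0] \<and> avoids e [0, 0, 1] \<longleftrightarrow>
      \<not> (\<exists>u. subseq u e \<and> (order_isomorphic u [0, 0, 0::nat] \<or> order_isomorphic u [0, 0, 1::nat]))"
    unfolding avoids_def by blast
  also have "\<dots> \<longleftrightarrow> \<not> (\<exists>a c. subseq [a, a, c] e \<and> a \<le> c)"
    unfolding order_isomorphic_000_or_001_iff by blast
  also have "\<dots> \<longleftrightarrow>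
      \<not> (\<exists>i j k. i < j \<and> j < k \<and> k < length e \<and> e ! i = e ! j \<and> e ! j \<le> e ! k)"
    unfolding subseq_three_iff_nth by (auto, metis)
  finally show ?thesis .
qed

lemma I_patterns_000_001_eq_I_relations:
  "I_patterns n {[0, 0, 0], [0, 0, 1]} = I_relations n (=) (\<le>) no_condition"
  using avoids_000_001_iff
  by (auto simp: I_patterns_def I_relations_def inversion_sequences_def no_condition_def)

definition staircase_then_decreasing :: "nat \<Rightarrow> nat set \<Rightarrow> nat list" where
  "staircase_then_decreasing m S = [0..<m] @ rev (sorted_list_of_set S)"

lemma set_staircase_then_decreasing:
  assumes "S \<subseteq> {..<m}"
  shows "set (staircase_then_decreasing m S) = {..<m}"
  using assms finite_subset[OF assms] by (auto simp: staircase_then_decreasing_def)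

text \<open>The length \<open>m\<close> of the staircase is recovered as the number of distinct entries, because the
  decreasing part only repeats values of the staircase.\<close>

lemma inj_on_staircase_then_decreasing:
  "inj_on (\<lambda>(m, S). staircase_then_decreasing m S) (SIGMA m:A. {S. S \<subseteq> {..<m} \<and> P m S})"
proof (rule inj_onI, clarify)
  fix m S m' S'
  assume S: "S \<subseteq> {..<m}" and S': "S' \<subseteq> {..<m'}"
    and eq: "staircase_then_decreasing m S = staircase_then_decreasing m' S'"
  have "{..<m} = {..<m'}"
    using set_staircase_then_decreasing S S' eq by metis
  then have m: "m = m'"
    by simp
  with eq have "sorted_list_of_set S = sorted_list_of_set S'"
    by (simp add: staircase_then_decreasing_def)
  moreover have "finite S" "finite S'"
    using S S' finite_subset by blast+
  ultimately show "m = m' \<and> S = S'"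
    using m by (metis set_sorted_list_of_set)
qed

lemma staircase_then_decreasing_in_I_relations:
  assumes "m \<le> n" and S: "S \<subseteq> {..<m}" and card: "card S = n - m"
  shows "staircase_then_decreasing m S \<in> I_relations n (=) (\<le>) no_condition"
proof -
  define e where "e = staircase_then_decreasing m S"
  define d where "d = rev (sorted_list_of_set S)"
  have "finite S"
    using S finite_subset by blast
  then have set_d: "set d = S"
    by (simp add: d_def)
  have len_d: "length d = n - m"
    by (simp add: d_def card)
  have decr: "sorted_wrt (>) d"
    by (simp add: d_def sorted_wrt_rev)
  have e: "e = [0..<m] @ d"
    by (simp add: e_def d_def staircase_then_decreasing_def)
  have len: "length e = n"
    using assms(1) by (simp add: e len_d)
  have low: "e ! i = i" if "i < m" for i
    using that by (simp add: e nth_append)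
  have high: "e ! i < m" if "m \<le> i" "i < n" for i
  proof -
    have "d ! (i - m) \<in> set d"
      using that by (intro nth_mem) (simp add: len_d)
    then show ?thesis
      using that S set_d by (auto simp: e nth_append)
  qed
  have "e ! i \<le> i" if "i < n" for i
    using low[of i] high[of i] that by (cases "i < m") auto
  moreover have "e ! k < e ! j" if "i < j" "j < k" "k < n" "e ! i = e ! j" for i j k
  proof -
    \<comment> \<open>Staircase entries are distinct, so the second of two equal entries lies in the
      decreasing part; the first may lie in the staircase.\<close>
    have "m \<le> j"
      using low[of i] low[of j] that by (cases "j < m") auto
    then have "d ! (k - m) < d ! (j - m)"
      using that by (intro sorted_wrt_nth_less[OF decr]) (auto simp: len_d)
    then show ?thesis
      using \<open>m \<le> j\<close> that by (simp add: e nth_append)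
  qed
  ultimately show ?thesis
    using len unfolding I_relations_def inversion_sequences_def e_def[symmetric]
    by (fastforce simp: not_le[symmetric])
qed

text \<open>The bound \<open>e\<^sub>i \<le> i\<close> is what makes the first entry off the staircase fall below it, hence
  repeat one of its values; the forbidden configuration then controls everything that follows.\<close>

lemma I_relations_imp_staircase_then_decreasing:
  assumes "e \<in> I_relations n (=) (\<le>) no_condition"
  obtains m S where "m \<le> n" "S \<subseteq> {..<m}" "card S = n - m" "e = staircase_then_decreasing m S"
proof -
  have len: "length e = n" and bound: "\<And>i. i < n \<Longrightarrow> e ! i \<le> i"
    and repeat: "\<And>i j k. \<lbrakk>i < j; j < k; k < n; e ! i = e ! j\<rbrakk> \<Longrightarrow> e ! k < e ! j"
    using assms by (auto simp: I_relations_def inversion_sequences_def no_condition_def not_le)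
  define m where "m = (LEAST i. i = n \<or> e ! i \<noteq> i)"
  have m: "m = n \<or> e ! m \<noteq> m"
    unfolding m_def by (rule LeastI[of _ n]) simp
  have "m \<le> n"
    unfolding m_def by (rule Least_le) simp
  have low: "e ! i = i" if "i < m" for i
    using not_less_Least that unfolding m_def by blast
  \<comment> \<open>An entry \<open>v < m\<close> at a position \<open>j \<ge> m\<close> repeats the staircase entry at position \<open>v\<close>.\<close>
  have below: "e ! k < e ! j" if "m \<le> j" "e ! j < m" "j < k" "k < n" for j k
    using repeat[of "e ! j" j k] low[of "e ! j"] that by simp
  have high: "e ! k < m" if "m \<le> k" "k < n" for k
  proof -
    have "e ! m < m"
      using m bound[of m] that by force
    then show ?thesis
      using below[of m k] that by (cases "k = m") auto
  qed
  define d where "d = drop m e"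
  have "take m e = [0..<m]"
    using \<open>m \<le> n\<close> len low by (intro nth_equalityI) auto
  then have e: "e = [0..<m] @ d"
    unfolding d_def by (metis append_take_drop_id)
  have "sorted_wrt (>) d"
    unfolding sorted_wrt_iff_nth_less d_def using below high len by auto
  then have sorted: "sorted_wrt (<) (rev d)"
    by (simp add: sorted_wrt_rev)
  then have "sorted_list_of_set (set d) = rev d"
    by (metis set_rev sorted_list_of_set.idem_if_sorted_distinct strict_sorted_iff)
  then have "e = staircase_then_decreasing m (set d)"
    by (simp add: e staircase_then_decreasing_def)
  moreover have "card (set d) = n - m"
    using sorted len by (metis d_def distinct_card distinct_rev length_drop strict_sorted_iff)
  moreover have "set d \<subseteq> {..<m}"
    using high len by (auto simp: d_def in_set_conv_nth)
  ultimately show ?thesis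
    using that \<open>m \<le> n\<close> by blast
qed

lemma card_I_relations_eq_fib: "card (I_relations n (=) (\<le>) no_condition) = fib (n + 1)"
proof -
  let ?X = "SIGMA m:{..n}. {S. S \<subseteq> {..<m} \<and> card S = n - m}"
  let ?f = "\<lambda>(m, S). staircase_then_decreasing m S"
  have "I_relations n (=) (\<le>) no_condition = ?f ` ?X"
    using staircase_then_decreasing_in_I_relations
    by (force elim: I_relations_imp_staircase_then_decreasing)
  then have "card (I_relations n (=) (\<le>) no_condition) = card ?X"
    by (simp add: card_image inj_on_staircase_then_decreasing)
  also have "\<dots> = (\<Sum>m\<le>n. m choose (n - m))"
    by (simp add: n_subsets)
  also have "\<dots> = (\<Sum>k\<le>n. (n - k) choose k)"
    by (rule sum.reindex_bij_witness[of _ "\<lambda>k. n - k" "\<lambda>k. n - k"]) auto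
  also have "\<dots> = fib (n + 1)"
    using ne_diagonal_fib[of n] by (simp add: atMost_atLeast0)
  finally show ?thesis .
qed

theorem theorem2p10:
  fixes n :: nat
  assumes "n \<ge> 1"
  shows "I_patterns n {[0, 0, 0], [0, 0, 1]} = I_relations n (=) (\<le>) no_condition \<and>
    card (I_patterns n {[0, 0, 0], [0, 0, 1]}) = fib (n + 1)"
  unfolding I_patterns_000_001_eq_I_relations card_I_relations_eq_fib by blast

end
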